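(* Let $q$ be a prime power and $n$ a positive integer with $\gcd(n,q)=1$. Let $E=\{e_1(x),\dots,e_t(x)\}$ be the set of primitive idempotents of $R_{q,n}=\mathbb{F}_q[x]/\langle x^n-1\rangle$. Let $F(x)=\sum_{i=0}^{n-1} a_i x^{q^i}$ with $a_i\in\mathbb{F}_q$. Then $F(x)$ is a linear involution over $\mathbb{F}_{q^n}$ if and only if its conventional $q$-associate $f(x)=\sum_{i=0}^{n-1}a_ix^i$ is of the form $$f(x)\equiv \sum_{i=1}^t f_i(x)e_i(x) \mod x^n-1,$$ for some $f_1(x),\dots,f_t(x)\in R_{q,n}$ with $f_i^2(x)\equiv 1 \mod x^n-1$ for all $1\le i\le t$.
   Context: A polynomial $F(x)=\sum_{i=0}^{n-1} a_i x^{q^i}$ is a linear involution over $\mathbb{F}_{q^n}$ if $(F\circ F)(x)\equiv x \mod x^{q^n}-x$. The conventional $q$-associate of $\sum_{i=0}^{n-1} a_i x^{q^i}$ is $\sum_{i=0}^{n-1} a_i x^i$. In the claim, $f_i^2(x)=f_i(x)f_i(x)$ is the ordinary product. Since $\gcd(n,q)=1$, the ring $R_{q,n}$ is semisimple; its primitive idempotents are the nonzero idempotents $e$ that cannot be written as $e=\overline{e}+\tilde{e}$ with $\overline{e},\tilde{e}$ nonzero idempotents satisfying $\overline{e}\,\tilde{e}=0$. They are pairwise orthogonal and sum to $1$. *)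

theory Defs
  imports "HOL-Library.Cardinality" "HOL-Number_Theory.Cong" "HOL-Computational_Algebra.Polynomial"
begin

definition q_polynomial :: "nat \<Rightarrow> nat \<Rightarrow> (nat \<Rightarrow> 'a::comm_ring_1) \<Rightarrow> 'a poly" where
  "q_polynomial q n a = (\<Sum>i<n. monom (a i) (q ^ i))"

definition q_associate :: "nat \<Rightarrow> (nat \<Rightarrow> 'a::comm_ring_1) \<Rightarrow> 'a poly" where
  "q_associate n a = (\<Sum>i<n. monom (a i) i)"

text \<open>
  Being a linear involution over the field with \<open>q ^ n\<close> elements depends on that field only
  through the modulus \<open>x ^ (q ^ n) - x\<close>. The congruence is stated over the coefficient field of
  \<open>F\<close>; since the modulus is monic, passing to an extension field does not change it.
\<close>

definition linear_involution :: "nat \<Rightarrow> nat \<Rightarrow> 'a::field poly \<Rightarrow> bool" where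
  "linear_involution q n F \<longleftrightarrow> [F \<circ>\<^sub>p F = monom 1 1] (mod (monom 1 (q ^ n) - monom 1 1))"

abbreviation cyc_modulus :: "nat \<Rightarrow> 'a::field poly" where
  "cyc_modulus n \<equiv> monom 1 n - 1"

text \<open>
  The elements of the quotient of the polynomial ring by the ideal generated by
  \<open>x ^ n - 1\<close> are represented by their unique representatives of degree less than
  \<open>n\<close>; equality in the quotient is congruence of polynomials. The bound is written on the
  coefficients because the degree of the zero polynomial is \<open>0\<close>.
\<close>

definition cyc_residues :: "nat \<Rightarrow> 'a::field poly set" where
  "cyc_residues n = {p. \<forall>k\<ge>n. coeff p k = 0}"

lemma cyc_residues_representatives:
  fixes p :: "'a::field poly"
  assumes "n > 0"
  shows "\<exists>!r. r \<in> cyc_residues n \<and> [p = r] (mod cyc_modulus n)"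
proof -
  have deg: "degree (cyc_modulus n :: 'a poly) = n"
  proof (rule antisym)
    show "degree (cyc_modulus n :: 'a poly) \<le> n"
      by (rule degree_diff_le) (auto simp: degree_monom_le)
    show "n \<le> degree (cyc_modulus n :: 'a poly)"
      by (rule le_degree) (use assms in \<open>simp add: coeff_eq_0\<close>)
  qed
  then have nz: "cyc_modulus n \<noteq> (0 :: 'a poly)"
    using assms by auto
  have mem: "r \<in> cyc_residues n \<longleftrightarrow> r mod cyc_modulus n = r" for r :: "'a poly"
  proof
    assume "r \<in> cyc_residues n"
    then have "degree r < n"
      unfolding cyc_residues_def
      by (metis (mono_tags, lifting) assms degree_0 leI leading_coeff_0_iff mem_Collect_eq)
    then show "r mod cyc_modulus n = r"
      by (simp add: mod_poly_less deg)
  next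
    assume "r mod cyc_modulus n = r"
    then have "r = 0 \<or> degree r < n"
      using degree_mod_less[OF nz, of r] deg by simp
    then show "r \<in> cyc_residues n"
      by (auto simp: cyc_residues_def coeff_eq_0)
  qed
  show ?thesis
    by (rule ex1I[of _ "p mod cyc_modulus n"]) (auto simp: mem cong_def)
qed

definition nonzero_idempotent :: "nat \<Rightarrow> 'a::field poly \<Rightarrow> bool" where
  "nonzero_idempotent n e \<longleftrightarrow>
     e \<in> cyc_residues n \<and> [e * e = e] (mod cyc_modulus n) \<and> \<not> [e = 0] (mod cyc_modulus n)"

definition primitive_idempotents :: "nat \<Rightarrow> 'a::field poly set" where
  "primitive_idempotents n =
     {e. nonzero_idempotent n e \<and>
         \<not> (\<exists>e1 e2. nonzero_idempotent n e1 \<and> nonzero_idempotent n e2 \<and>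
              [e1 * e2 = 0] (mod cyc_modulus n) \<and> [e = e1 + e2] (mod cyc_modulus n))}"

end

theory Submission
  imports Defs
begin

text \<open>
  Write \<open>L f\<close> for the polynomial \<open>\<Sum> a\<^sub>i x ^ (q ^ i)\<close> attached to \<open>f = \<Sum> a\<^sub>i x ^ i\<close>, so that
  \<open>F = L f\<close>. Both the \<open>q\<close>-th power map on polynomials and the map \<open>L\<close> are additive, and on
  the coefficients the \<open>q\<close>-th power is the identity. Hence multiplying \<open>f\<close> by \<open>x\<close> amounts to
  raising \<open>L f\<close> to the \<open>q\<close>-th power, and it follows that \<open>L\<close> turns products into compositions
  (\<open>linearized_mult\<close>). Moreover \<open>L\<close> carries \<open>x ^ n - 1\<close> to \<open>x ^ (q ^ n) - x\<close>, and it respects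
  divisibility by these two polynomials in both directions
  (\<open>field_modulus_dvd_linearized_iff\<close>). Therefore \<open>F \<circ> F\<close> is congruent to \<open>x\<close> exactly if
  \<open>f\<^sup>2\<close> is congruent to \<open>1\<close>: linear involutions correspond to the square roots of \<open>1\<close> in the
  quotient ring modulo \<open>x ^ n - 1\<close> (\<open>linear_involution_iff_square\<close>).

  The primitive idempotents of this finite ring are orthogonal and have the sum \<open>1\<close>
  (\<open>primitive_idempotents_orthogonal\<close>, \<open>sum_primitive_idempotents\<close>), so an element is determined
  by its products with them, and the product of \<open>\<Sum> f\<^sub>i e\<^sub>i\<close> with \<open>e\<^sub>j\<close> is \<open>f\<^sub>j e\<^sub>j\<close>. If every
  \<open>f\<^sub>i\<^sup>2\<close> is \<open>1\<close>, then the square of the sum agrees with \<open>1\<close> after multiplication with each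
  \<open>e\<^sub>j\<close>, hence equals \<open>1\<close>. Conversely, a square root \<open>f\<close> of \<open>1\<close> is \<open>\<Sum> f e\<^sub>i\<close>.
\<close>

section \<open>Frobenius over a finite field\<close>

text \<open>
  Multiplication by a nonzero \<open>c\<close> permutes the nonzero elements; comparing their product
  before and after gives \<open>c ^ (q - 1) = 1\<close>.
\<close>

lemma finite_field_power_card:
  fixes c :: "'a::{field,finite}"
  shows "c ^ CARD('a) = c"
proof (cases "c = 0")
  case False
  let ?U = "UNIV - {0 :: 'a}"
  have "bij_betw ((*) c) ?U ?U"
    by (rule bij_betw_byWitness[of _ "\<lambda>y. y / c"]) (use False in auto)
  then have "(\<Prod>y\<in>?U. c * y) = \<Prod>?U"
    by (rule prod.reindex_bij_betw)
  then have "c ^ card ?U = 1"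
    by (simp add: prod.distrib)
  moreover have "CARD('a) = Suc (card ?U)"
    by (simp add: card_Diff_singleton card_gt_0_iff)
  ultimately show ?thesis
    by (metis mult.right_neutral power_Suc)
qed (simp add: zero_power card_gt_0_iff)

text \<open>
  The polynomial \<open>(x + 1) ^ q - x ^ q - 1\<close> vanishes at all \<open>q\<close> elements of the field although its
  degree is less than \<open>q\<close>. So it is zero, and its coefficients are these binomial coefficients.
  This gives additivity of the \<open>q\<close>-th power without writing \<open>q\<close> as a power of the
  characteristic.
\<close>

lemma of_nat_choose_card_eq_0:
  assumes "0 < k" and "k < CARD('a::{field,finite})"
  shows "of_nat (CARD('a) choose k) = (0 :: 'a)"
proof -
  let ?q = "CARD('a)"
  define p :: "'a poly" where "p = (\<Sum>i\<in>{0<..<?q}. monom (of_nat (?q choose i)) i)"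
  have split: "{..?q} = insert 0 (insert ?q {0<..<?q})"
    using assms by auto
  have "poly p c = 0" for c
  proof -
    have "(c + 1) ^ ?q = (\<Sum>i\<le>?q. of_nat (?q choose i) * c ^ i)"
      by (simp add: binomial_ring)
    also have "\<dots> = 1 + c ^ ?q + poly p c"
      using assms unfolding split by (simp add: p_def poly_sum poly_monom)
    finally show ?thesis
      by (simp add: finite_field_power_card)
  qed
  then have roots: "card {c. poly p c = 0} = ?q"
    by simp
  have "degree p \<le> ?q - 1"
  proof -
    have "degree (monom (of_nat (?q choose i) :: 'a) i) \<le> ?q - 1" if "i \<in> {0<..<?q}" for i
      using that degree_monom_le[of "of_nat (?q choose i) :: 'a" i]
      by (auto intro: order_trans)
    then show ?thesis
      unfolding p_def by (intro degree_sum_le finite_greaterThanLessThan)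
  qed
  with assms have "degree p < ?q"
    by simp
  with roots have "p = 0"
    using card_poly_roots_bound[of p] by (metis leD)
  moreover have "coeff p k = of_nat (?q choose k)"
    using assms by (simp add: p_def coeff_sum)
  ultimately show ?thesis
    by simp
qed

lemma poly_add_power_card:
  fixes f g :: "'a::{field,finite} poly"
  shows "(f + g) ^ CARD('a) = f ^ CARD('a) + g ^ CARD('a)"
proof -
  let ?q = "CARD('a)"
  have q: "?q > 0"
    by (simp add: card_gt_0_iff)
  then have split: "{..?q} = insert 0 (insert ?q {0<..<?q})"
    by auto
  have "(\<Sum>i\<in>{0<..<?q}. of_nat (?q choose i) * f ^ i * g ^ (?q - i)) = 0"
    by (rule sum.neutral) (auto simp: of_nat_poly of_nat_choose_card_eq_0)
  then show ?thesis
    using q unfolding binomial_ring split by simp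
qed

lemma poly_sum_power_card:
  fixes f :: "'b \<Rightarrow> 'a::{field,finite} poly"
  shows "(\<Sum>i\<in>I. f i) ^ CARD('a) = (\<Sum>i\<in>I. f i ^ CARD('a))"
  by (induction I rule: infinite_finite_induct)
    (simp_all add: poly_add_power_card zero_power card_gt_0_iff)

section \<open>The linearized associate of a polynomial\<close>

definition linearized :: "nat \<Rightarrow> 'a::comm_ring_1 poly \<Rightarrow> 'a poly" where
  "linearized q f = (\<Sum>i\<le>degree f. monom (coeff f i) (q ^ i))"

text \<open>
  The summation bound in the definition depends on \<open>f\<close>. Any larger bound gives the same value,
  so polynomials of different degrees can be compared under a common bound.
\<close>

lemma linearized_eq_sum:
  assumes "degree f < N"
  shows "linearized q f = (\<Sum>i<N. monom (coeff f i) (q ^ i))"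
  unfolding linearized_def
  by (rule sum.mono_neutral_left) (use assms in \<open>auto simp: coeff_eq_0\<close>)

lemma linearized_0 [simp]: "linearized q 0 = 0"
  by (simp add: linearized_def)

lemma linearized_add: "linearized q (f + g) = linearized q f + linearized q g"
proof -
  define N where "N = Suc (max (degree f) (degree g))"
  have "degree f < N" "degree g < N" "degree (f + g) < N"
    using degree_add_le_max[of f g] by (auto simp: N_def)
  then show ?thesis
    by (simp add: linearized_eq_sum[where N = N] sum.distrib flip: add_monom)
qed

lemma linearized_smult: "linearized q (smult c f) = smult c (linearized q f)"
proof -
  have "linearized q (smult c f) = (\<Sum>i<Suc (degree f). monom (coeff (smult c f) i) (q ^ i))"
    using degree_smult_le[of c f] by (intro linearized_eq_sum) simp
  also have "\<dots> = smult c (\<Sum>i<Suc (degree f). monom (coeff f i) (q ^ i))"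
    by (simp add: poly_eq_iff coeff_sum sum_distrib_left if_distrib del: sum.lessThan_Suc cong: if_cong)
  finally show ?thesis
    by (simp only: linearized_eq_sum[of f "Suc (degree f)"] lessI)
qed

lemma linearized_diff: "linearized q (f - g) = linearized q f - linearized q g"
  using linearized_add[of q "f - g" g] by simp

lemma linearized_sum: "linearized q (\<Sum>i\<in>I. f i) = (\<Sum>i\<in>I. linearized q (f i))"
  by (induction I rule: infinite_finite_induct) (simp_all add: linearized_add)

lemma linearized_monom: "linearized q (monom c k) = monom c (q ^ k)"
proof (cases "c = 0")
  case False
  then have "linearized q (monom c k) = (\<Sum>i\<le>k. if i = k then monom c (q ^ k) else 0)"
    unfolding linearized_def by (intro sum.cong) (auto simp: degree_monom_eq)
  then show ?thesis
    by simp
qed simp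

lemma linearized_q_associate: "linearized q (q_associate n a) = q_polynomial q n a"
  by (simp add: q_associate_def q_polynomial_def linearized_sum linearized_monom)

text \<open>
  Multiplication by \<open>x\<close> shifts the exponents \<open>q ^ i\<close> to \<open>q ^ (i + 1)\<close>, which is the effect of the
  \<open>q\<close>-th power because that power is additive and fixes the coefficients.
\<close>

lemma linearized_pCons:
  fixes f :: "'a::{field,finite} poly"
  shows "linearized CARD('a) (pCons c f) = monom c 1 + linearized CARD('a) f ^ CARD('a)"
proof -
  let ?q = "CARD('a)"
  have "linearized ?q (pCons c f) = (\<Sum>i<Suc (Suc (degree f)). monom (coeff (pCons c f) i) (?q ^ i))"
    using degree_pCons_le[of c f] by (intro linearized_eq_sum) simp
  also have "\<dots> = monom c 1 + (\<Sum>i<Suc (degree f). monom (coeff f i) (?q ^ Suc i))"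
    unfolding sum.lessThan_Suc_shift[of _ "Suc (degree f)"] by simp
  also have "(\<Sum>i<Suc (degree f). monom (coeff f i) (?q ^ Suc i)) =
      (\<Sum>i<Suc (degree f). monom (coeff f i) (?q ^ i)) ^ ?q"
    unfolding poly_sum_power_card monom_power finite_field_power_card by (simp add: mult.commute)
  finally show ?thesis
    by (simp only: linearized_eq_sum[of f "Suc (degree f)"] lessI)
qed

text \<open>
  By induction on \<open>f\<close>: substituting \<open>L g\<close> into \<open>c x + (L f) ^ q\<close> gives \<open>c (L g) + (L (f g)) ^ q\<close>,
  which is \<open>L\<close> of \<open>c g + x f g\<close>.
\<close>

lemma linearized_mult:
  fixes f g :: "'a::{field,finite} poly"
  shows "linearized CARD('a) (f * g) = linearized CARD('a) f \<circ>\<^sub>p linearized CARD('a) g"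
proof (induction f)
  case (pCons c f)
  let ?L = "linearized CARD('a)"
  have pcompose_power: "(p ^ k) \<circ>\<^sub>p r = (p \<circ>\<^sub>p r) ^ k" for p r :: "'a poly" and k
    by (induction k) (simp_all add: pcompose_mult pcompose_1)
  have "?L (pCons c f * g) = smult c (?L g) + ?L (f * g) ^ CARD('a)"
    by (simp add: linearized_add linearized_smult linearized_pCons)
  also have "\<dots> = (monom c 1 + ?L f ^ CARD('a)) \<circ>\<^sub>p ?L g"
    by (simp add: pCons.IH pcompose_add pcompose_power monom_Suc monom_0 pcompose_pCons)
  finally show ?case
    by (simp add: linearized_pCons)
qed simp

section \<open>Reduction modulo \<open>x ^ n - 1\<close> and modulo \<open>x ^ (q ^ n) - x\<close>\<close>

lemma degree_cyc_modulus:
  assumes "n > 0"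
  shows "degree (cyc_modulus n :: 'a::field poly) = n"
  using degree_add_eq_left[of "- 1" "monom (1 :: 'a) n"] assms by (simp add: degree_monom_eq)

lemma cyc_residues_iff_degree:
  assumes "n > 0"
  shows "p \<in> cyc_residues n \<longleftrightarrow> degree p < n"
proof
  assume "p \<in> cyc_residues n"
  then show "degree p < n"
    using assms leading_coeff_0_iff[of p]
    by (cases "p = 0") (auto simp: cyc_residues_def intro: leI dest: spec[of _ "degree p"])
qed (simp add: cyc_residues_def coeff_eq_0)

lemma mod_cyc_modulus_in_residues:
  fixes p :: "'a::field poly"
  assumes "n > 0"
  shows "p mod cyc_modulus n \<in> cyc_residues n"
proof (cases "p mod cyc_modulus n = 0")
  case False
  have deg: "degree (cyc_modulus n :: 'a poly) = n"
    using degree_cyc_modulus[OF assms] .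
  then have "cyc_modulus n \<noteq> (0 :: 'a poly)"
    using assms by force
  from degree_mod_less'[OF this False] show ?thesis
    unfolding cyc_residues_iff_degree[OF assms] deg .
qed (simp add: cyc_residues_def)

text \<open>For \<open>q > 1\<close> the exponents \<open>q ^ i\<close> are distinct, so no two coefficients are merged.\<close>

lemma linearized_eq_0_imp:
  assumes "q > 1" and "linearized q f = 0"
  shows "f = 0"
proof (rule poly_eqI)
  fix k
  define N where "N = Suc (max k (degree f))"
  have "0 = coeff (\<Sum>i<N. monom (coeff f i) (q ^ i)) (q ^ k)"
    using assms linearized_eq_sum[of f N q] by (simp add: N_def)
  also have "\<dots> = (\<Sum>i<N. if i = k then coeff f k else 0)"
    using assms by (auto simp: coeff_sum intro!: sum.cong)
  also have "\<dots> = coeff f k"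
    by (simp add: N_def)
  finally show "coeff f k = coeff 0 k"
    by simp
qed

text \<open>
  With \<open>P = x ^ (q ^ n) - x\<close> and \<open>M = x ^ n - 1\<close> one has \<open>P = L M\<close>. A multiple \<open>h M\<close> is sent to
  \<open>L h\<close> evaluated at \<open>P\<close>, which \<open>P\<close> divides because \<open>L h\<close> has no constant term. For the converse,
  subtracting a multiple of \<open>M\<close> leaves the remainder \<open>r\<close> of \<open>f\<close>; then \<open>L r\<close> is divisible by \<open>P\<close> but
  has a smaller degree, so it is zero.
\<close>

lemma field_modulus_dvd_linearized_iff:
  fixes f :: "'a::{field,finite} poly"
  assumes "n > 0"
  shows "monom 1 (CARD('a) ^ n) - monom 1 1 dvd linearized CARD('a) f \<longleftrightarrow> cyc_modulus n dvd f"
    (is "?P dvd ?L f \<longleftrightarrow> ?M dvd f")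
proof -
  let ?q = "CARD('a)"
  have q: "?q > 1"
    using card_mono[of UNIV "{0, 1 :: 'a}"] by simp
  have PL: "?P = ?L ?M"
    using linearized_monom[of ?q "1 :: 'a" 0]
    by (simp add: linearized_diff linearized_monom)
  have multiple: "?P dvd ?L (h * ?M)" for h
  proof -
    have "coeff (?L h) 0 = 0"
      using q by (simp add: linearized_def coeff_sum)
    then obtain u where "?L h = pCons 0 u"
      by (metis coeff_pCons_0 pCons_cases)
    then show ?thesis
      unfolding linearized_mult PL by (simp add: pcompose_pCons)
  qed
  show ?thesis
  proof
    assume "?M dvd f"
    then obtain h where "f = h * ?M"
      by (metis dvd_def mult.commute)
    then show "?P dvd ?L f"
      using multiple by simp
  next
    assume dvd: "?P dvd ?L f"
    define r where "r = f mod ?M"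
    have "f = f div ?M * ?M + r"
      unfolding r_def by (rule div_mult_mod_eq[symmetric])
    then have "?L f = ?L (f div ?M * ?M) + ?L r"
      by (metis linearized_add)
    with dvd multiple have "?P dvd ?L r"
      by (metis dvd_add_right_iff)
    have r: "degree r < n"
      using mod_cyc_modulus_in_residues[OF assms] cyc_residues_iff_degree[OF assms] r_def by blast
    have "degree (?L r) \<le> ?q ^ degree r"
      unfolding linearized_def using q
      by (intro degree_sum_le) (auto intro!: order_trans[OF degree_monom_le] power_increasing)
    also have "\<dots> < ?q ^ n"
      using q r by simp
    also have "\<dots> \<le> degree ?P"
      by (rule le_degree) (use one_less_power[OF q assms] in simp)
    finally have "?L r = 0"
      using \<open>?P dvd ?L r\<close> by (meson dvd_imp_degree_le leD)
    then have "r = 0"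
      using q linearized_eq_0_imp by blast
    then show "?M dvd f"
      by (simp add: r_def mod_eq_0_iff_dvd)
  qed
qed

lemma linear_involution_iff_square:
  fixes a :: "nat \<Rightarrow> 'a::{field,finite}"
  assumes "n > 0"
  shows "linear_involution CARD('a) n (q_polynomial CARD('a) n a) \<longleftrightarrow>
    [(q_associate n a)\<^sup>2 = 1] (mod cyc_modulus n)"
proof -
  let ?f = "q_associate n a" and ?L = "linearized CARD('a)"
  have "?L (?f\<^sup>2 - 1) = ?L ?f \<circ>\<^sub>p ?L ?f - monom 1 1"
    using linearized_monom[of "CARD('a)" "1 :: 'a" 0]
    by (simp add: linearized_diff linearized_mult power2_eq_square)
  then show ?thesis
    using field_modulus_dvd_linearized_iff[OF assms, of "?f\<^sup>2 - 1"]
    by (simp add: linear_involution_def cong_iff_dvd_diff linearized_q_associate)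
qed

section \<open>Primitive idempotents\<close>

lemma finite_cyc_residues: "finite (cyc_residues n :: 'a::{field,finite} poly set)"
proof (rule finite_subset)
  show "cyc_residues n \<subseteq> Poly ` {xs :: 'a list. set xs \<subseteq> UNIV \<and> length xs = n}"
  proof
    fix p :: "'a poly"
    assume p: "p \<in> cyc_residues n"
    then have "p = Poly (map (coeff p) [0..<n])"
      by (intro poly_eqI) (auto simp: cyc_residues_def coeff_Poly_eq nth_default_def)
    then show "p \<in> Poly ` {xs :: 'a list. set xs \<subseteq> UNIV \<and> length xs = n}"
      by (intro image_eqI) auto
  qed
qed (intro finite_imageI finite_lists_length_eq finite)

lemma nonzero_idempotent_mod:
  assumes "n > 0" and "[g * g = g] (mod cyc_modulus n)" and "\<not> [g = 0] (mod cyc_modulus n)"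
  shows "nonzero_idempotent n (g mod cyc_modulus n)"
  using assms mod_cyc_modulus_in_residues[OF assms(1), of g]
  by (simp add: nonzero_idempotent_def cong_def mod_mult_eq)

text \<open>
  Primitivity forbids only decompositions into reduced representatives. Reducing the summands
  extends this to arbitrary polynomials that are idempotent modulo \<open>x ^ n - 1\<close>.
\<close>

lemma primitive_idempotent_split:
  assumes "n > 0" and "e \<in> primitive_idempotents n"
    and "[g * g = g] (mod cyc_modulus n)" and "[h * h = h] (mod cyc_modulus n)"
    and "[g * h = 0] (mod cyc_modulus n)" and "[e = g + h] (mod cyc_modulus n)"
  shows "[g = 0] (mod cyc_modulus n) \<or> [h = 0] (mod cyc_modulus n)"
proof (rule ccontr)
  let ?M = "cyc_modulus n :: 'a poly"
  assume "\<not> ?thesis"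
  then have "nonzero_idempotent n (g mod ?M)" "nonzero_idempotent n (h mod ?M)"
    using assms nonzero_idempotent_mod by blast+
  moreover have "[g mod ?M * (h mod ?M) = 0] (mod ?M)" "[e = g mod ?M + h mod ?M] (mod ?M)"
    using assms by (simp_all add: cong_def mod_mult_eq mod_add_eq)
  ultimately show False
    using assms(2) unfolding primitive_idempotents_def by blast
qed

text \<open>An idempotent \<open>g\<close> splits \<open>e\<close> into the orthogonal idempotents \<open>e g\<close> and \<open>e - e g\<close>.\<close>

lemma primitive_idempotent_mult_cases:
  assumes "n > 0" and "e \<in> primitive_idempotents n" and "[g * g = g] (mod cyc_modulus n)"
  shows "[e * g = 0] (mod cyc_modulus n) \<or> [e * g = e] (mod cyc_modulus n)"
proof -
  let ?M = "cyc_modulus n :: 'a poly"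
  have ee: "[e * e = e] (mod ?M)"
    using assms(2) by (simp add: primitive_idempotents_def nonzero_idempotent_def)
  have eeg: "[e * e * g = e * g] (mod ?M)"
    using ee by (rule cong_scalar_right)
  have egeg: "[e * g * (e * g) = e * g] (mod ?M)"
    using cong_mult[OF ee assms(3)] by (simp add: ac_simps)
  have orth: "[e * g * (e - e * g) = 0] (mod ?M)"
    using cong_diff[OF eeg egeg] by (simp add: algebra_simps)
  have "[e * g = 0] (mod ?M) \<or> [e - e * g = 0] (mod ?M)"
  proof (rule primitive_idempotent_split[OF assms(1,2) egeg _ orth])
    show "[(e - e * g) * (e - e * g) = e - e * g] (mod ?M)"
      using cong_diff[OF cong_diff[OF ee eeg] orth] by (simp add: algebra_simps)
  qed simp
  then show ?thesis
    by (metis cong_diff_iff_cong_0 cong_sym)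
qed

text \<open>
  If \<open>e e'\<close> is nonzero, then it equals both \<open>e\<close> and \<open>e'\<close>, since each factor absorbs or kills the
  other.
\<close>

lemma primitive_idempotents_orthogonal:
  assumes "n > 0" and e: "e \<in> primitive_idempotents n" and e': "e' \<in> primitive_idempotents n"
    and "e \<noteq> e'"
  shows "[e * e' = 0] (mod cyc_modulus n)"
proof (rule ccontr)
  let ?M = "cyc_modulus n :: 'a poly"
  assume "\<not> ?thesis"
  moreover have "[e * e = e] (mod ?M)" "[e' * e' = e'] (mod ?M)"
    and res: "e \<in> cyc_residues n" "e' \<in> cyc_residues n"
    using e e' by (auto simp: primitive_idempotents_def nonzero_idempotent_def)
  ultimately have "[e * e' = e] (mod ?M)" "[e' * e = e'] (mod ?M)"
    using primitive_idempotent_mult_cases[OF assms(1)] e e' by (metis mult.commute)+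
  then have "[e = e'] (mod ?M)"
    by (metis cong_sym cong_trans mult.commute)
  then show False
    using res cyc_residues_representatives[OF assms(1), of e] assms(4) by (metis cong_refl)
qed

text \<open>
  Call \<open>e\<close> below \<open>d\<close> if \<open>e d = e\<close>. A nonzero idempotent \<open>d\<close> that is not primitive is a sum of orthogonal nonzero idempotents \<open>g\<close>
  and \<open>h\<close>. Everything below \<open>g\<close> is below \<open>d\<close>, whereas \<open>h\<close> is below \<open>d\<close> but not below \<open>g\<close>.
  As the ring is finite, passing from \<open>d\<close> to \<open>g\<close> must end at a primitive idempotent.
\<close>

lemma primitive_idempotent_below:
  fixes d :: "'a::{field,finite} poly"
  assumes "n > 0" and "nonzero_idempotent n d"
  shows "\<exists>e\<in>primitive_idempotents n. [e * d = e] (mod cyc_modulus n)"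
proof -
  let ?M = "cyc_modulus n :: 'a poly"
  define below where "below g = {h \<in> cyc_residues n. [h * g = h] (mod ?M)}" for g
  have fin: "finite (below g)" for g
    by (rule finite_subset[OF _ finite_cyc_residues[of n]]) (auto simp: below_def)
  show ?thesis
    using assms(2)
  proof (induction "card (below d)" arbitrary: d rule: less_induct)
    case less
    show ?case
    proof (cases "d \<in> primitive_idempotents n")
      case True
      then show ?thesis
        using less.prems by (auto simp: nonzero_idempotent_def)
    next
      case False
      then obtain g h where g: "nonzero_idempotent n g" and h: "nonzero_idempotent n h"
        and gh: "[g * h = 0] (mod ?M)" and d: "[d = g + h] (mod ?M)"
        using less.prems unfolding primitive_idempotents_def by blast
      have gg: "[g * g = g] (mod ?M)" and hh: "[h * h = h] (mod ?M)"
        using g h by (auto simp: nonzero_idempotent_def)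
      have "[g * d = g * g + g * h] (mod ?M)"
        using cong_scalar_left[OF d, of g] by (simp add: distrib_left)
      also have "[g * g + g * h = g + 0] (mod ?M)"
        using gg gh by (rule cong_add)
      finally have gd: "[g * d = g] (mod ?M)"
        by simp
      have "[h * d = g * h + h * h] (mod ?M)"
        using cong_scalar_left[OF d, of h] by (simp add: distrib_left mult.commute)
      also have "[g * h + h * h = 0 + h] (mod ?M)"
        using gh hh by (rule cong_add)
      finally have hd: "[h * d = h] (mod ?M)"
        by simp
      have sub: "below g \<subseteq> below d"
      proof
        fix p assume "p \<in> below g"
        then have p: "p \<in> cyc_residues n" "[p * g = p] (mod ?M)"
          by (auto simp: below_def)
        have "[p * d = p * g * d] (mod ?M)"
          using cong_scalar_right[OF cong_sym[OF p(2)]] .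
        also have "[p * g * d = p * g] (mod ?M)"
          using cong_scalar_left[OF gd, of p] by (simp add: mult.assoc)
        also note p(2)
        finally show "p \<in> below d"
          using p(1) by (simp add: below_def)
      qed
      have "h \<notin> below g"
      proof
        assume "h \<in> below g"
        then have "[h = 0] (mod ?M)"
          using gh by (simp add: below_def) (metis cong_sym cong_trans mult.commute)
        then show False
          using h by (simp add: nonzero_idempotent_def)
      qed
      moreover have "h \<in> below d"
        using h hd by (simp add: below_def nonzero_idempotent_def)
      ultimately have "card (below g) < card (below d)"
        using sub fin by (metis psubsetI psubset_card_mono)
      then obtain e where e: "e \<in> primitive_idempotents n" "[e * g = e] (mod ?M)"
        using less.hyps[OF _ g] by blast
      then have "e \<in> below g"
        by (auto simp: below_def primitive_idempotents_def nonzero_idempotent_def)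
      then show ?thesis
        using sub e(1) by (auto simp: below_def)
    qed
  qed
qed

text \<open>Multiplication by a primitive idempotent extracts one component of a combination.\<close>

lemma sum_primitive_idempotents_mult:
  fixes e :: "'a::{field,finite} poly"
  assumes "n > 0" and "e \<in> primitive_idempotents n"
  shows "[(\<Sum>p\<in>primitive_idempotents n. c p * p) * e = c e * e] (mod cyc_modulus n)"
proof -
  let ?M = "cyc_modulus n :: 'a poly" and ?E = "primitive_idempotents n :: 'a poly set"
  have "finite ?E"
    by (rule finite_subset[OF _ finite_cyc_residues[of n]])
      (auto simp: primitive_idempotents_def nonzero_idempotent_def)
  have "[(\<Sum>p\<in>?E. c p * (p * e)) = (\<Sum>p\<in>?E. if p = e then c e * e else 0)] (mod ?M)"
  proof (rule cong_sum)
    fix p assume p: "p \<in> ?E"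
    have "[e * e = e] (mod ?M)"
      using assms(2) by (simp add: primitive_idempotents_def nonzero_idempotent_def)
    moreover have "[p * e = 0] (mod ?M)" if "p \<noteq> e"
      using primitive_idempotents_orthogonal[OF assms(1) p assms(2) that] .
    ultimately show "[c p * (p * e) = (if p = e then c e * e else 0)] (mod ?M)"
      using cong_scalar_left[of "p * e" 0 ?M "c p"] by (auto intro: cong_scalar_left)
  qed
  then show ?thesis
    using \<open>finite ?E\<close> assms(2) by (simp add: sum_distrib_right mult.assoc)
qed

text \<open>
  Let \<open>s\<close> be the sum. If the idempotent \<open>1 - s\<close> were nonzero, some primitive idempotent \<open>e\<close> would
  lie below it. But \<open>s e = e\<close> by orthogonality, so \<open>e = e (1 - s) = 0\<close>.
\<close>

lemma sum_primitive_idempotents: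
  assumes "n > 0"
  shows "[(\<Sum>e\<in>primitive_idempotents n. e) = (1 :: 'a::{field,finite} poly)] (mod cyc_modulus n)"
proof (rule ccontr)
  let ?M = "cyc_modulus n :: 'a poly" and ?E = "primitive_idempotents n :: 'a poly set"
  define s where "s = (\<Sum>e\<in>?E. e)"
  assume "\<not> ?thesis"
  then have nz: "\<not> [1 - s = 0] (mod ?M)"
    by (metis s_def cong_diff_iff_cong_0 cong_sym)
  have se: "[s * e = e] (mod ?M)" if "e \<in> ?E" for e
    using sum_primitive_idempotents_mult[OF assms that, of "\<lambda>_. 1"] by (simp add: s_def)
  have "[s * s = s] (mod ?M)"
    using cong_sum[of ?E "\<lambda>e. s * e" "\<lambda>e. e" ?M] se
    by (simp add: sum_distrib_left[symmetric] s_def[symmetric])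
  then have "[(1 - s) * (1 - s) = 1 - s] (mod ?M)"
    by (simp add: cong_iff_dvd_diff algebra_simps)
  then obtain e where e: "e \<in> ?E" "[e * ((1 - s) mod ?M) = e] (mod ?M)"
    using primitive_idempotent_below[OF assms nonzero_idempotent_mod[OF assms _ nz]] by blast
  then have "[e * (1 - s) = e] (mod ?M)"
    by (simp add: cong_def mod_mult_right_eq)
  moreover have "[e * (1 - s) = 0] (mod ?M)"
    using cong_diff[OF cong_refl[of e] se[OF e(1)]] by (simp add: algebra_simps)
  ultimately have "[e = 0] (mod ?M)"
    using cong_sym cong_trans by blast
  then show False
    using e(1) by (simp add: primitive_idempotents_def nonzero_idempotent_def)
qed

section \<open>The characterization\<close>

theorem corollary28:
  fixes q n t :: nat
    and a :: "nat \<Rightarrow> 'a::{field,finite}"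
    and e :: "nat \<Rightarrow> 'a poly"
  assumes "q = CARD('a)"
    and "n > 0"
    and "coprime n q"
    and "bij_betw e {1..t} (primitive_idempotents n)"
  shows "linear_involution q n (q_polynomial q n a) \<longleftrightarrow>
    (\<exists>f :: nat \<Rightarrow> 'a poly.
       (\<forall>i\<in>{1..t}. f i \<in> cyc_residues n \<and> [(f i)\<^sup>2 = 1] (mod cyc_modulus n)) \<and>
       [q_associate n a = (\<Sum>i=1..t. f i * e i)] (mod cyc_modulus n))"
proof -
  let ?M = "cyc_modulus n :: 'a poly" and ?E = "primitive_idempotents n :: 'a poly set"
  let ?F = "q_associate n a"
  have unit: "[(\<Sum>p\<in>?E. p) = 1] (mod ?M)"
    using sum_primitive_idempotents[OF assms(2)] .
  have "[?F\<^sup>2 = 1] (mod ?M) \<longleftrightarrow> (\<exists>f :: nat \<Rightarrow> 'a poly.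
       (\<forall>i\<in>{1..t}. f i \<in> cyc_residues n \<and> [(f i)\<^sup>2 = 1] (mod ?M)) \<and>
       [?F = (\<Sum>i=1..t. f i * e i)] (mod ?M))"
  proof
    assume square: "[?F\<^sup>2 = 1] (mod ?M)"
    have "?F \<in> cyc_residues n"
      by (auto simp: cyc_residues_def q_associate_def coeff_sum intro!: sum.neutral)
    moreover have "(\<Sum>i=1..t. ?F * e i) = ?F * (\<Sum>p\<in>?E. p)"
      unfolding sum_distrib_left by (rule sum.reindex_bij_betw[OF assms(4)])
    then have "[?F = (\<Sum>i=1..t. ?F * e i)] (mod ?M)"
      using cong_sym[OF cong_scalar_left[OF unit, of ?F]] by simp
    ultimately show "\<exists>f :: nat \<Rightarrow> 'a poly.
       (\<forall>i\<in>{1..t}. f i \<in> cyc_residues n \<and> [(f i)\<^sup>2 = 1] (mod ?M)) \<and>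
       [?F = (\<Sum>i=1..t. f i * e i)] (mod ?M)"
      using square by (intro exI[of _ "\<lambda>_. ?F"]) simp
  next
    assume "\<exists>f :: nat \<Rightarrow> 'a poly.
       (\<forall>i\<in>{1..t}. f i \<in> cyc_residues n \<and> [(f i)\<^sup>2 = 1] (mod ?M)) \<and>
       [?F = (\<Sum>i=1..t. f i * e i)] (mod ?M)"
    then obtain f :: "nat \<Rightarrow> 'a poly" where f: "\<And>i. i \<in> {1..t} \<Longrightarrow> [(f i)\<^sup>2 = 1] (mod ?M)"
      and F: "[?F = (\<Sum>i=1..t. f i * e i)] (mod ?M)"
      by blast
    \<comment> \<open>Indexing the coefficients by the idempotents themselves turns the sum over \<open>i\<close> into one over
      the set of primitive idempotents.\<close>
    define c where "c p = f (the_inv_into {1..t} e p)" for p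
    have ce: "c (e i) = f i" if "i \<in> {1..t}" for i
      using the_inv_into_f_f[OF bij_betw_imp_inj_on[OF assms(4)] that] by (simp add: c_def)
    have "(\<Sum>i=1..t. f i * e i) = (\<Sum>i=1..t. c (e i) * e i)"
      by (simp add: ce)
    also have "\<dots> = (\<Sum>p\<in>?E. c p * p)"
      by (rule sum.reindex_bij_betw[OF assms(4)])
    finally have F': "[?F = (\<Sum>p\<in>?E. c p * p)] (mod ?M)"
      using F by simp
    have square: "[?F\<^sup>2 * p = p] (mod ?M)" if p: "p \<in> ?E" for p
    proof -
      obtain i where "i \<in> {1..t}" "p = e i"
        using p bij_betw_imp_surj_on[OF assms(4)] by (metis imageE)
      then have cp: "[(c p)\<^sup>2 = 1] (mod ?M)"
        using f ce by simp
      have Fp: "[?F * p = c p * p] (mod ?M)"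
        using cong_trans[OF cong_scalar_right[OF F'] sum_primitive_idempotents_mult[OF assms(2) p]] .
      have "[?F * (?F * p) = ?F * (c p * p)] (mod ?M)"
        using Fp by (rule cong_scalar_left)
      also have "?F * (c p * p) = c p * (?F * p)"
        by (simp add: mult.left_commute)
      also have "[c p * (?F * p) = c p * (c p * p)] (mod ?M)"
        using Fp by (rule cong_scalar_left)
      also have "c p * (c p * p) = (c p)\<^sup>2 * p"
        by (simp add: power2_eq_square mult.assoc)
      also have "[(c p)\<^sup>2 * p = 1 * p] (mod ?M)"
        using cp by (rule cong_scalar_right)
      finally show ?thesis
        by (simp add: power2_eq_square mult.assoc)
    qed
    have "[?F\<^sup>2 = ?F\<^sup>2 * (\<Sum>p\<in>?E. p)] (mod ?M)"
      using cong_sym[OF cong_scalar_left[OF unit, of "?F\<^sup>2"]] by simp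
    also have "[?F\<^sup>2 * (\<Sum>p\<in>?E. p) = (\<Sum>p\<in>?E. p)] (mod ?M)"
      unfolding sum_distrib_left using square by (rule cong_sum)
    also note unit
    finally show "[?F\<^sup>2 = 1] (mod ?M)" .
  qed
  then show ?thesis
    using linear_involution_iff_square[OF assms(2), of a] unfolding assms(1) by (rule trans[rotated])
qed

end
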